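(* Let $(G^{\theta})_{\theta\in\Theta}$ be a parameterized family of basic games satisfying the baseline assumptions given in the context (with $f$ known), $S=((\mathcal{T}_i)_i,\pi)$ a fixed information structure, $\phi$ the true conditional choice probabilities, and $\Theta_I=\Theta_I(\phi)$ the Markov correlated equilibrium identified set at $\phi$. Let $\alpha\in(0,1)$ and let $\Phi_\alpha$ be a (data-dependent, sample size $n$) confidence region for $\phi$ such that $$\liminf_{n\to\infty}\Pr(\phi\in\Phi_\alpha)\ge 1-\alpha.$$ Define $\widehat\Theta_I^\alpha\equiv\bigcup_{\tilde\phi\in\Phi_\alpha}\Theta_I(\tilde\phi)$. Then $$\liminf_{n\to\infty}\Pr\big(\Theta_I\subseteq\widehat\Theta_I^\alpha\big)\ge 1-\alpha.$$ Moreover, $\theta\in\widehat\Theta_I^\alpha$ if and only if there exists a triple $(\sigma,V,\tilde\phi)$ with $\tilde\phi\in\Phi_\alpha$ satisfying $$\sigma_{a\mid x,\varepsilon,\tau}\ge 0\ \text{ for each } a\ \text{ and }\ \sum_a\sigma_{a\mid x,\varepsilon,\tau}=1,\quad\forall x,\varepsilon,\tau,$$ $$\tilde\phi_{a\mid x}=\sum_{\varepsilon,\tau}\psi^\theta_{\varepsilon\mid x}\pi_{\tau\mid x,\varepsilon}\sigma_{a\mid x,\varepsilon,\tau},\quad\forall a,x,$$ $$\sum_{\varepsilon,\tau_{-i},a_{-i}}\psi^\theta_{\varepsilon\mid x}\pi_{\tau\mid x,\varepsilon}\sigma_{a\mid x,\varepsilon,\tau}\,\partial v_i^\theta(a_i',a,x,\varepsilon_i)\le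 0,\quad\forall i,x,\tau_i,a_i,a_i',$$ $$V_{i,x}=\sum_{\varepsilon,\tau,a}\psi^\theta_{\varepsilon\mid x}\pi_{\tau\mid x,\varepsilon}\sigma_{a\mid x,\varepsilon,\tau}u_i^\theta(a,x,\varepsilon_i)+\delta\sum_{a,x'}\tilde\phi_{a\mid x}V_{i,x'}f_{x'\mid a,x},\quad\forall i,x,$$ where $v_i^\theta(a,x,\varepsilon_i)\equiv u_i^\theta(a,x,\varepsilon_i)+\delta\sum_{x'}V_{i,x'}f_{x'\mid a,x}$ and $\partial v_i^\theta(a_i',a,x,\varepsilon_i)\equiv v_i^\theta(a_i',a_{-i},x,\varepsilon_i)-v_i^\theta(a_i,a_{-i},x,\varepsilon_i)$.
   Context: **Games.** $\Delta(Y)$ is the set of probability distributions on a finite set $Y$. A basic game $G=\langle \mathcal{I},(\mathcal{A}_i,u_i)_{i\in\mathcal{I}},\mathcal{X},\mathcal{E},\psi,f,\delta\rangle$ consists of players $\mathcal{I}=\{1,\dots,I\}$, finite nonempty action sets $\mathcal{A}_i$ with $\mathcal{A}=\times_i\mathcal{A}_i$, a finite set $\mathcal{X}$ of public states, a finite set $\mathcal{E}$ of latent states, a prior $\psi_{\varepsilon\mid x}$ (for each $x$ a distribution on $\mathcal{E}$), transition probabilities $f_{x'\mid a,x,\varepsilon}$, flow payoffs $u_i:\mathcal{A}\times\mathcal{X}\times\mathcal{E}\to\mathbb{R}$, and a discount factor $\delta\in[0,1)$. An information structure $S=((\mathcal{T}_i)_{i\in\mathcal{I}},\pi)$ consists of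 finite nonempty signal sets $\mathcal{T}_i$, $\mathcal{T}=\times_i\mathcal{T}_i$, and $\pi:\mathcal{X}\times\mathcal{E}\to\Delta(\mathcal{T})$, written $\pi_{\tau\mid x,\varepsilon}$. **Baseline assumptions.** $G^\theta=\langle\mathcal{I},(\mathcal{A}_i,u_i^\theta)_{i\in\mathcal{I}},\mathcal{X},\mathcal{E},\psi^\theta,f,\delta\rangle$; $\mathcal{X}$ and $\mathcal{E}$ are finite; $\psi^\theta$ and $u_i^\theta$ are known up to the finite-dimensional parameter $\theta\in\Theta$; latent states are vectors of player-specific shocks $\varepsilon=(\varepsilon_1,\dots,\varepsilon_I)$, $\varepsilon_i\in\mathcal{E}_i$, with $u_i^\theta(a,x,\varepsilon)=u_i^\theta(a,x,\varepsilon_i)$; $f_{x'\mid a,x,\varepsilon}=f_{x'\mid a,x}$ with $f:\mathcal{A}\times\mathcal{X}\to\Delta(\mathcal{X})$ known; $\delta$ is known. The true conditional choice probabilities are $\phi:\mathcal{X}\to\Delta(\mathcal{A})$. **Markov correlated equilibrium (MCE).** A decision rule for $(G,S)$ is a map $\sigma:\mathcal{X}\times\mathcal{E}\times\mathcal{T}\to\Delta(\mathcal{A})$. Let $V_i^\sigma\in\mathbb{R}^{|\mathcal{X}|}$ be the unique solution of $V_i^\sigma(x)=\sum_{\varepsilon,\tau,a}\psi_{\varepsilon\mid x}\pi_{\tau\mid x,\varepsilon}\sigma_{a\mid x,\varepsilon,\tau}\{u_i(a,x,\varepsilon)+\delta\sum_{x'}V_i^\sigma(x')f_{x'\mid a,x,\varepsilon}\}$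 for all $x$, and $v_i^\sigma(a,x,\varepsilon)=u_i(a,x,\varepsilon)+\delta\sum_{x'}V_i^\sigma(x')f_{x'\mid a,x,\varepsilon}$. Then $\sigma$ is an MCE of $(G,S)$ if for all $i,x,\tau_i,a_i,a_i'$, $$\sum_{\varepsilon,\tau_{-i},a_{-i}}\psi_{\varepsilon\mid x}\pi_{\tau\mid x,\varepsilon}\sigma_{a\mid x,\varepsilon,\tau}v_i^\sigma(a,x,\varepsilon)\ge\sum_{\varepsilon,\tau_{-i},a_{-i}}\psi_{\varepsilon\mid x}\pi_{\tau\mid x,\varepsilon}\sigma_{a\mid x,\varepsilon,\tau}v_i^\sigma(a_i',a_{-i},x,\varepsilon).$$ **Identified set.** For $\tilde\phi=(\tilde\phi_{a\mid x})$, $\Theta_I(\tilde\phi)$ is the set of $\theta\in\Theta$ such that some MCE $\sigma$ of $(G^\theta,S)$ satisfies $\tilde\phi_{a\mid x}=\sum_{\varepsilon,\tau}\psi^\theta_{\varepsilon\mid x}\pi_{\tau\mid x,\varepsilon}\sigma_{a\mid x,\varepsilon,\tau}$ for all $a,x$. **Confidence region.** For each sample size $n$, $\Phi_\alpha$ is a random subset (depending on the sample of size $n$) of the space of vectors $(\tilde\phi_{a\mid x})_{a,x}$; $\Pr$ is the probability over samples, and the events $\{\phi\in\Phi_\alpha\}$ and $\{\Theta_I\subseteq\widehat\Theta_I^\alpha\}$ are taken to be measurable. *)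

theory Defs
  imports "HOL-Probability.Probability"
begin

(* p is an element of Delta(Y); its values outside the finite set Y are irrelevant. *)
definition dist_on :: "'y set \<Rightarrow> ('y \<Rightarrow> real) \<Rightarrow> bool" where
  "dist_on Y p \<longleftrightarrow> (\<forall>y\<in>Y. 0 \<le> p y) \<and> (\<Sum>y\<in>Y. p y) = 1"

(* Conditioning variables are the leading arguments:
   g_prior G x e is psi(e | x) and g_trans G a x e x' is f(x' | a, x, e).
   The actions of all players live in one type 'a; player i uses the subset g_acts G i. *)
record ('a, 'x, 'e) basic_game =
  g_num :: nat
  g_acts :: "nat \<Rightarrow> 'a set"
  g_payoff :: "nat \<Rightarrow> (nat \<Rightarrow> 'a) \<Rightarrow> 'x \<Rightarrow> 'e \<Rightarrow> real"
  g_states :: "'x set"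
  g_latent :: "'e set"
  g_prior :: "'x \<Rightarrow> 'e \<Rightarrow> real"
  g_trans :: "(nat \<Rightarrow> 'a) \<Rightarrow> 'x \<Rightarrow> 'e \<Rightarrow> 'x \<Rightarrow> real"
  g_disc :: real

(* i_prob S x e t is pi(t | x, e). *)
record ('t, 'x, 'e) info_structure =
  i_signals :: "nat \<Rightarrow> 't set"
  i_prob :: "'x \<Rightarrow> 'e \<Rightarrow> (nat \<Rightarrow> 't) \<Rightarrow> real"

definition players :: "('a, 'x, 'e) basic_game \<Rightarrow> nat set" where
  "players G = {1..g_num G}"

definition action_profiles :: "('a, 'x, 'e) basic_game \<Rightarrow> (nat \<Rightarrow> 'a) set" where
  "action_profiles G = PiE (players G) (g_acts G)"

definition signal_profiles ::
    "('a, 'x, 'e) basic_game \<Rightarrow> ('t, 'x, 'e) info_structure \<Rightarrow> (nat \<Rightarrow> 't) set" where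
  "signal_profiles G S = PiE (players G) (i_signals S)"

definition is_basic_game :: "('a, 'x, 'e) basic_game \<Rightarrow> bool" where
  "is_basic_game G \<longleftrightarrow>
     (\<forall>i\<in>players G. finite (g_acts G i) \<and> g_acts G i \<noteq> {}) \<and>
     finite (g_states G) \<and> finite (g_latent G) \<and>
     (\<forall>x\<in>g_states G. dist_on (g_latent G) (g_prior G x)) \<and>
     (\<forall>a\<in>action_profiles G. \<forall>x\<in>g_states G. \<forall>e\<in>g_latent G.
        dist_on (g_states G) (g_trans G a x e)) \<and>
     0 \<le> g_disc G \<and> g_disc G < 1"

definition is_info_structure ::
    "('a, 'x, 'e) basic_game \<Rightarrow> ('t, 'x, 'e) info_structure \<Rightarrow> bool" where
  "is_info_structure G S \<longleftrightarrow>
     (\<forall>i\<in>players G. finite (i_signals S i) \<and> i_signals S i \<noteq> {}) \<and>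
     (\<forall>x\<in>g_states G. \<forall>e\<in>g_latent G. dist_on (signal_profiles G S) (i_prob S x e))"

(* s x e t a is sigma(a | x, e, t). *)
type_synonym ('a, 'x, 'e, 't) decision_rule =
  "'x \<Rightarrow> 'e \<Rightarrow> (nat \<Rightarrow> 't) \<Rightarrow> (nat \<Rightarrow> 'a) \<Rightarrow> real"

definition is_decision_rule ::
    "('a, 'x, 'e) basic_game \<Rightarrow> ('t, 'x, 'e) info_structure \<Rightarrow>
     ('a, 'x, 'e, 't) decision_rule \<Rightarrow> bool" where
  "is_decision_rule G S \<sigma> \<longleftrightarrow>
     (\<forall>x\<in>g_states G. \<forall>e\<in>g_latent G. \<forall>t\<in>signal_profiles G S.
        dist_on (action_profiles G) (\<sigma> x e t))"

(* The Bellman equation for player i; its solutions are made extensional on the states so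
   that "the unique solution" is literally unique as a HOL function. *)
definition is_value ::
    "('a, 'x, 'e) basic_game \<Rightarrow> ('t, 'x, 'e) info_structure \<Rightarrow>
     ('a, 'x, 'e, 't) decision_rule \<Rightarrow> nat \<Rightarrow> ('x \<Rightarrow> real) \<Rightarrow> bool" where
  "is_value G S \<sigma> i V \<longleftrightarrow>
     V \<in> extensional (g_states G) \<and>
     (\<forall>x\<in>g_states G. V x =
        (\<Sum>e\<in>g_latent G. \<Sum>t\<in>signal_profiles G S. \<Sum>a\<in>action_profiles G.
           g_prior G x e * i_prob S x e t * \<sigma> x e t a *
           (g_payoff G i a x e + g_disc G * (\<Sum>x'\<in>g_states G. V x' * g_trans G a x e x'))))"

definition ex_ante_value ::
    "('a, 'x, 'e) basic_game \<Rightarrow> ('t, 'x, 'e) info_structure \<Rightarrow>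
     ('a, 'x, 'e, 't) decision_rule \<Rightarrow> nat \<Rightarrow> 'x \<Rightarrow> real" where
  "ex_ante_value G S \<sigma> i = (THE V. is_value G S \<sigma> i V)"

definition choice_value ::
    "('a, 'x, 'e) basic_game \<Rightarrow> ('t, 'x, 'e) info_structure \<Rightarrow>
     ('a, 'x, 'e, 't) decision_rule \<Rightarrow> nat \<Rightarrow> (nat \<Rightarrow> 'a) \<Rightarrow> 'x \<Rightarrow> 'e \<Rightarrow> real" where
  "choice_value G S \<sigma> i a x e =
     g_payoff G i a x e +
     g_disc G * (\<Sum>x'\<in>g_states G. ex_ante_value G S \<sigma> i x' * g_trans G a x e x')"

(* Markov correlated equilibrium. A sum over t_{-i} (a_{-i}) at a given own component is the
   sum over the full profiles whose i-th component is that one; (b', a_{-i}) is a(i := b'). *)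
definition is_MCE ::
    "('a, 'x, 'e) basic_game \<Rightarrow> ('t, 'x, 'e) info_structure \<Rightarrow>
     ('a, 'x, 'e, 't) decision_rule \<Rightarrow> bool" where
  "is_MCE G S \<sigma> \<longleftrightarrow>
     is_decision_rule G S \<sigma> \<and>
     (\<forall>i\<in>players G. \<forall>x\<in>g_states G. \<forall>ti\<in>i_signals S i. \<forall>b\<in>g_acts G i. \<forall>b'\<in>g_acts G i.
        (\<Sum>e\<in>g_latent G. \<Sum>t | t \<in> signal_profiles G S \<and> t i = ti.
           \<Sum>a | a \<in> action_profiles G \<and> a i = b.
             g_prior G x e * i_prob S x e t * \<sigma> x e t a * choice_value G S \<sigma> i a x e)
        \<ge> (\<Sum>e\<in>g_latent G. \<Sum>t | t \<in> signal_profiles G S \<and> t i = ti.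
           \<Sum>a | a \<in> action_profiles G \<and> a i = b.
             g_prior G x e * i_prob S x e t * \<sigma> x e t a *
             choice_value G S \<sigma> i (a(i := b')) x e))"

(* The finite-dimensional space of vectors (p(a | x)), written p x a; extensionality makes
   equality of such functions the same as equality of the vectors. *)
definition ccp_space ::
    "'x set \<Rightarrow> (nat \<Rightarrow> 'a) set \<Rightarrow> ('x \<Rightarrow> (nat \<Rightarrow> 'a) \<Rightarrow> real) set" where
  "ccp_space X AA = PiE X (\<lambda>_. PiE AA (\<lambda>_. UNIV))"

definition identified_set ::
    "'p set \<Rightarrow> ('p \<Rightarrow> ('a, 'x, 'e) basic_game) \<Rightarrow> ('t, 'x, 'e) info_structure \<Rightarrow>
     ('x \<Rightarrow> (nat \<Rightarrow> 'a) \<Rightarrow> real) \<Rightarrow> 'p set" where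
  "identified_set \<Theta> G S p =
     {\<theta> \<in> \<Theta>. \<exists>\<sigma>. is_MCE (G \<theta>) S \<sigma> \<and>
        (\<forall>x\<in>g_states (G \<theta>). \<forall>a\<in>action_profiles (G \<theta>).
           p x a = (\<Sum>e\<in>g_latent (G \<theta>). \<Sum>t\<in>signal_profiles (G \<theta>) S.
                      g_prior (G \<theta>) x e * i_prob S x e t * \<sigma> x e t a))}"

definition confidence_set ::
    "'p set \<Rightarrow> ('p \<Rightarrow> ('a, 'x, 'e) basic_game) \<Rightarrow> ('t, 'x, 'e) info_structure \<Rightarrow>
     ('x \<Rightarrow> (nat \<Rightarrow> 'a) \<Rightarrow> real) set \<Rightarrow> 'p set" where
  "confidence_set \<Theta> G S \<Phi> = (\<Union>p\<in>\<Phi>. identified_set \<Theta> G S p)"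

(* The parameterized family under the baseline assumptions: latent states are vectors of
   player-specific shocks, player i's payoff depends on e only through e i, the transition
   does not depend on e, and only payoffs and prior vary with the parameter. *)
definition baseline_family ::
    "nat \<Rightarrow> (nat \<Rightarrow> 'a set) \<Rightarrow> ('p \<Rightarrow> nat \<Rightarrow> (nat \<Rightarrow> 'a) \<Rightarrow> 'x \<Rightarrow> 's \<Rightarrow> real) \<Rightarrow> 'x set \<Rightarrow>
     (nat \<Rightarrow> 's) set \<Rightarrow> ('p \<Rightarrow> 'x \<Rightarrow> (nat \<Rightarrow> 's) \<Rightarrow> real) \<Rightarrow>
     ((nat \<Rightarrow> 'a) \<Rightarrow> 'x \<Rightarrow> 'x \<Rightarrow> real) \<Rightarrow> real \<Rightarrow> 'p \<Rightarrow> ('a, 'x, nat \<Rightarrow> 's) basic_game" where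
  "baseline_family N A u X E \<psi> f \<delta> \<theta> =
     \<lparr> g_num = N, g_acts = A, g_payoff = (\<lambda>i a x e. u \<theta> i a x (e i)),
       g_states = X, g_latent = E, g_prior = \<psi> \<theta>, g_trans = (\<lambda>a x e. f a x),
       g_disc = \<delta> \<rparr>"

end

theory Submission imports Defs
begin

text \<open>
  The coverage claim is monotonicity: if the true CCP vector lies in the region, its identified
  set is one of the sets united in the confidence set. For the characterization, a decision rule
  induces a stochastic matrix on the public states, so the Bellman equation is a discounted linear
  fixed point equation with exactly one solution (Neumann series). Hence any solution \<open>V\<close> of
  the stated equation, in which the consistent CCPs absorb the marginal over latent states and
  signals, is the ex ante value, and the obedience constraints say the same thing.
\<close>

text \<open>Used once per layer of randomness (latent state, signal, action) to see that the
  transition between public states induced by a decision rule is stochastic.\<close>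

lemma dist_on_mixture:
  assumes "dist_on Y w" and "\<And>y. y \<in> Y \<Longrightarrow> dist_on Z (q y)"
  shows "dist_on Z (\<lambda>z. \<Sum>y\<in>Y. w y * q y z)"
proof -
  have "(\<Sum>z\<in>Z. \<Sum>y\<in>Y. w y * q y z) = (\<Sum>y\<in>Y. w y * (\<Sum>z\<in>Z. q y z))"
    by (subst sum.swap) (simp add: sum_distrib_left)
  also have "\<dots> = 1"
    using assms by (simp add: dist_on_def)
  finally show ?thesis
    using assms by (auto simp: dist_on_def intro!: sum_nonneg)
qed

text \<open>Pulls a test function through one layer of mixing; repeated rewriting with it flattens
  the nested kernel of \<open>ex1_is_value\<close>.\<close>

lemma sum_mixture:
  fixes w :: "'y \<Rightarrow> real"
  shows "(\<Sum>z\<in>Z. (\<Sum>y\<in>Y. w y * q y z) * h z) = (\<Sum>y\<in>Y. w y * (\<Sum>z\<in>Z. q y z * h z))"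
  by (simp add: sum_distrib_left sum_distrib_right sum.swap[of _ Z Y] mult.assoc)

text \<open>Averaging does not increase the sup norm. With the factor \<open>\<delta>\<close> in
  front this is the contraction estimate behind both uniqueness and existence below.\<close>

lemma abs_sum_dist_on_le:
  assumes "dist_on Y p" and "\<And>y. y \<in> Y \<Longrightarrow> \<bar>h y\<bar> \<le> c"
  shows "\<bar>\<Sum>y\<in>Y. p y * h y\<bar> \<le> c"
proof -
  have "\<bar>\<Sum>y\<in>Y. p y * h y\<bar> \<le> (\<Sum>y\<in>Y. p y * \<bar>h y\<bar>)"
    using assms(1) by (intro order.trans[OF sum_abs] sum_mono) (simp add: abs_mult dist_on_def)
  also have "\<dots> \<le> (\<Sum>y\<in>Y. p y * c)"
    using assms by (intro sum_mono mult_left_mono) (auto simp: dist_on_def)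
  also have "\<dots> = c"
    using assms(1) by (simp add: dist_on_def flip: sum_distrib_right)
  finally show ?thesis .
qed

text \<open>The rewards cancel in the difference \<open>D\<close> of two solutions, leaving
  \<open>D = \<delta> P D\<close>. At a point where the modulus of \<open>D\<close> is maximal this
  gives \<open>m \<le> \<delta> * m\<close>, which forces \<open>m \<le> 0\<close> because
  \<open>\<delta> < 1\<close>.\<close>

lemma discounted_equation_unique:
  fixes \<delta> :: real
  assumes X: "finite X" and P: "\<And>x. x \<in> X \<Longrightarrow> dist_on X (P x)" and \<delta>: "0 \<le> \<delta>" "\<delta> < 1"
    and V: "\<And>x. x \<in> X \<Longrightarrow> V x = r x + \<delta> * (\<Sum>y\<in>X. P x y * V y)"
    and W: "\<And>x. x \<in> X \<Longrightarrow> W x = r x + \<delta> * (\<Sum>y\<in>X. P x y * W y)"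
    and x: "x \<in> X"
  shows "V x = W x"
proof -
  define D where "D y = V y - W y" for y
  define m where "m = Max ((\<lambda>y. \<bar>D y\<bar>) ` X)"
  have le: "\<bar>D y\<bar> \<le> m" if "y \<in> X" for y
    unfolding m_def using X that by simp
  \<comment> \<open>The maximum is attained: \<open>X\<close> is finite, and nonempty because it
    contains \<open>x\<close>.\<close>
  have "m \<in> (\<lambda>y. \<bar>D y\<bar>) ` X"
    unfolding m_def using X x by (intro Max_in) auto
  then obtain z where z: "z \<in> X" "m = \<bar>D z\<bar>"
    by blast
  have "D z = \<delta> * (\<Sum>y\<in>X. P z y * D y)"
    using V[OF z(1)] W[OF z(1)] by (simp add: D_def algebra_simps sum_subtractf)
  hence "m = \<delta> * \<bar>\<Sum>y\<in>X. P z y * D y\<bar>"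
    using z(2) \<delta>(1) by (simp add: abs_mult)
  also have "\<dots> \<le> \<delta> * m"
    using le z(1) \<delta>(1) by (intro mult_left_mono abs_sum_dist_on_le P) auto
  finally have "(1 - \<delta>) * m \<le> 0"
    by (simp add: algebra_simps)
  hence "m \<le> 0"
    using \<delta>(2) by (simp add: mult_le_0_iff)
  with le[OF x] show ?thesis
    by (simp add: D_def)
qed

text \<open>The solution is the Neumann series, the sum over \<open>n\<close> of
  \<open>(\<delta> P)^n r\<close>. It converges pointwise on \<open>X\<close> by comparison with a
  geometric series.\<close>

lemma discounted_equation_solution:
  fixes \<delta> :: real
  assumes X: "finite X" and P: "\<And>x. x \<in> X \<Longrightarrow> dist_on X (P x)" and \<delta>: "0 \<le> \<delta>" "\<delta> < 1"
  shows "\<exists>V. \<forall>x\<in>X. V x = r x + \<delta> * (\<Sum>y\<in>X. P x y * V y)"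
proof -
  \<comment> \<open>\<open>D n\<close> is the \<open>n\<close>-th term of the series. The sum
    \<open>C\<close> is a crude bound for the modulus of \<open>r\<close> on \<open>X\<close> that
    also makes sense for empty \<open>X\<close>.\<close>
  define D where "D n = ((\<lambda>g x. \<delta> * (\<Sum>y\<in>X. P x y * g y)) ^^ n) r" for n
  define C where "C = (\<Sum>x\<in>X. \<bar>r x\<bar>)"
  have D_Suc: "D (Suc n) x = \<delta> * (\<Sum>y\<in>X. P x y * D n y)" for n x
    by (simp add: D_def)
  have bound: "\<bar>D n x\<bar> \<le> C * \<delta> ^ n" if "x \<in> X" for n x
    using that
  \<comment> \<open>The point \<open>x\<close> must vary, since \<open>D (Suc n) x\<close> averages
    \<open>D n\<close> over all of \<open>X\<close>.\<close>
  proof (induction n arbitrary: x)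
    case 0
    thus ?case
      using X member_le_sum[of x X "\<lambda>x. \<bar>r x\<bar>"] by (simp add: D_def C_def)
  next
    case (Suc n)
    have "\<bar>D (Suc n) x\<bar> = \<delta> * \<bar>\<Sum>y\<in>X. P x y * D n y\<bar>"
      using \<delta>(1) by (simp add: D_Suc abs_mult)
    also have "\<dots> \<le> \<delta> * (C * \<delta> ^ n)"
      using Suc \<delta>(1) by (intro mult_left_mono abs_sum_dist_on_le P) auto
    finally show ?case
      by (simp add: mult_ac)
  qed
  have summ: "summable (\<lambda>n. D n x)" if "x \<in> X" for x
  proof (rule summable_comparison_test')
    show "summable (\<lambda>n. C * \<delta> ^ n)"
      using \<delta> by (intro summable_mult summable_geometric) simp
    show "norm (D n x) \<le> C * \<delta> ^ n" if "n \<ge> 0" for n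
      using bound[OF \<open>x \<in> X\<close>] by simp
  qed
  have "(\<Sum>n. D n x) = r x + \<delta> * (\<Sum>y\<in>X. P x y * (\<Sum>n. D n y))" if "x \<in> X" for x
  proof -
    \<comment> \<open>Applying \<open>\<delta> P\<close> termwise shifts the series by one index;
      the missing head \<open>D 0\<close> is the reward \<open>r\<close>.\<close>
    have "(\<lambda>n. \<delta> * (\<Sum>y\<in>X. P x y * D n y)) sums (\<delta> * (\<Sum>y\<in>X. P x y * (\<Sum>n. D n y)))"
      by (intro sums_mult sums_sum summable_sums summ)
    hence "(\<Sum>n. D (Suc n) x) = \<delta> * (\<Sum>y\<in>X. P x y * (\<Sum>n. D n y))"
      by (simp add: D_Suc sums_iff)
    moreover have "(\<Sum>n. D n x) = D 0 x + (\<Sum>n. D (Suc n) x)"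
      using suminf_split_head[OF summ[OF that]] by simp
    ultimately show ?thesis
      by (simp add: D_def)
  qed
  thus ?thesis
    by (intro exI[of _ "\<lambda>x. \<Sum>n. D n x"]) simp
qed

text \<open>Averaging out latent states, signals and actions turns the Bellman equation into
  \<open>V = r + \<delta> P V\<close> on the finite set of public states, so the two preceding
  lemmas apply. This justifies the definite description in \<open>ex_ante_value\<close>.\<close>

lemma ex1_is_value:
  fixes G :: "('a, 'x, 'e) basic_game" and S :: "('t, 'x, 'e) info_structure"
  assumes G: "is_basic_game G" and S: "is_info_structure G S" and \<sigma>: "is_decision_rule G S \<sigma>"
  shows "\<exists>!V. is_value G S \<sigma> i V"
proof -
  let ?X = "g_states G" and ?E = "g_latent G"
  let ?T = "signal_profiles G S" and ?A = "action_profiles G"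
  define r where "r x = (\<Sum>e\<in>?E. \<Sum>t\<in>?T. \<Sum>a\<in>?A.
      g_prior G x e * i_prob S x e t * \<sigma> x e t a * g_payoff G i a x e)" for x
  \<comment> \<open>The factors are nested rather than multiplied out so that
    \<open>dist_on_mixture\<close> fits layer by layer.\<close>
  define P where "P x y = (\<Sum>e\<in>?E. g_prior G x e * (\<Sum>t\<in>?T. i_prob S x e t *
      (\<Sum>a\<in>?A. \<sigma> x e t a * g_trans G a x e y)))" for x y
  have P: "dist_on ?X (P x)" if "x \<in> ?X" for x
    unfolding P_def using that G S \<sigma>
    by (intro dist_on_mixture)
      (auto simp: is_basic_game_def is_info_structure_def is_decision_rule_def)
  have \<delta>: "finite ?X" "0 \<le> g_disc G" "g_disc G < 1"
    using G by (auto simp: is_basic_game_def)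
  have bellman: "(\<Sum>e\<in>?E. \<Sum>t\<in>?T. \<Sum>a\<in>?A. g_prior G x e * i_prob S x e t * \<sigma> x e t a *
        (g_payoff G i a x e + g_disc G * (\<Sum>y\<in>?X. V y * g_trans G a x e y)))
      = r x + g_disc G * (\<Sum>y\<in>?X. P x y * V y)" for x V
  proof -
    have "(\<Sum>y\<in>?X. P x y * V y) = (\<Sum>e\<in>?E. \<Sum>t\<in>?T. \<Sum>a\<in>?A.
        g_prior G x e * i_prob S x e t * \<sigma> x e t a * (\<Sum>y\<in>?X. V y * g_trans G a x e y))"
      unfolding P_def sum_mixture by (simp add: sum_distrib_left mult_ac)
    thus ?thesis
      by (simp add: r_def distrib_left sum.distrib sum_distrib_left mult_ac)
  qed
  have is_value: "is_value G S \<sigma> i V \<longleftrightarrow>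
      V \<in> extensional ?X \<and> (\<forall>x\<in>?X. V x = r x + g_disc G * (\<Sum>y\<in>?X. P x y * V y))" for V
    by (simp add: is_value_def bellman)
  obtain V where "\<forall>x\<in>?X. V x = r x + g_disc G * (\<Sum>y\<in>?X. P x y * V y)"
    using discounted_equation_solution[of ?X P, OF \<delta>(1) P \<delta>(2,3)] by blast
  \<comment> \<open>The series solution is unconstrained off the states. Restricting it restores
    extensionality and keeps the equation, which reads \<open>V\<close> only on the states.\<close>
  hence "is_value G S \<sigma> i (restrict V ?X)"
    by (simp add: is_value)
  moreover have "V = W" if "is_value G S \<sigma> i V" "is_value G S \<sigma> i W" for V W
  proof (rule extensionalityI)
    show "V \<in> extensional ?X" "W \<in> extensional ?X"
      using that by (auto simp: is_value)
    show "V x = W x" if "x \<in> ?X" for x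
      by (rule discounted_equation_unique[where P = P and r = r, OF \<delta>(1) P \<delta>(2,3)])
        (use \<open>is_value G S \<sigma> i V\<close> \<open>is_value G S \<sigma> i W\<close> \<open>x \<in> ?X\<close> in \<open>auto simp: is_value\<close>)
  qed
  ultimately show ?thesis
    by blast
qed

lemma is_value_ex_ante_value:
  assumes "is_basic_game G" "is_info_structure G S" "is_decision_rule G S \<sigma>"
  shows "is_value G S \<sigma> i (ex_ante_value G S \<sigma> i)"
  unfolding ex_ante_value_def by (rule theI'[OF ex1_is_value[OF assms]])

lemma ex_ante_value_eqI:
  assumes "is_basic_game G" "is_info_structure G S" "is_decision_rule G S \<sigma>"
    and "is_value G S \<sigma> i V"
  shows "ex_ante_value G S \<sigma> i = V"
  unfolding ex_ante_value_def
  by (rule the1_equality, rule ex1_is_value[OF assms(1-3)], rule assms(4))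

text \<open>Since \<open>f\<close> does not depend on the latent state, the continuation term
  depends on \<open>a\<close> alone. Summing the joint weights over \<open>E\<close> and
  \<open>T\<close> first therefore replaces them by their marginal \<open>p\<close>.\<close>

lemma bellman_marginal:
  fixes w :: "'e \<Rightarrow> 't \<Rightarrow> 'a \<Rightarrow> real"
  assumes "\<And>a. a \<in> A \<Longrightarrow> p a = (\<Sum>e\<in>E. \<Sum>t\<in>T. w e t a)"
  shows "(\<Sum>e\<in>E. \<Sum>t\<in>T. \<Sum>a\<in>A. w e t a * (g a e + \<delta> * (\<Sum>y\<in>X. V y * f a y)))
       = (\<Sum>e\<in>E. \<Sum>t\<in>T. \<Sum>a\<in>A. w e t a * g a e) + \<delta> * (\<Sum>a\<in>A. \<Sum>y\<in>X. p a * V y * f a y)"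
proof -
  have "(\<Sum>e\<in>E. \<Sum>t\<in>T. \<Sum>a\<in>A. w e t a * h a) = (\<Sum>a\<in>A. p a * h a)" for h
  proof -
    have "(\<Sum>e\<in>E. \<Sum>t\<in>T. \<Sum>a\<in>A. w e t a * h a) = (\<Sum>e\<in>E. \<Sum>a\<in>A. \<Sum>t\<in>T. w e t a * h a)"
      by (intro sum.cong refl sum.swap)
    also have "\<dots> = (\<Sum>a\<in>A. \<Sum>e\<in>E. \<Sum>t\<in>T. w e t a * h a)"
      by (rule sum.swap)
    finally show ?thesis
      by (simp add: assms sum_distrib_right)
  qed
  from this[of "\<lambda>a. \<delta> * (\<Sum>y\<in>X. V y * f a y)"] show ?thesis
    by (simp add: distrib_left sum.distrib sum_distrib_left mult_ac)
qed

theorem theorem7: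
  fixes N :: nat
    and A :: "nat \<Rightarrow> 'a set"
    and AA :: "(nat \<Rightarrow> 'a) set"
    and X :: "'x set"
    and Es :: "nat \<Rightarrow> 's set"
    and E :: "(nat \<Rightarrow> 's) set"
    and \<Theta> :: "'p::euclidean_space set"
    and u :: "'p \<Rightarrow> nat \<Rightarrow> (nat \<Rightarrow> 'a) \<Rightarrow> 'x \<Rightarrow> 's \<Rightarrow> real"
    and \<psi> :: "'p \<Rightarrow> 'x \<Rightarrow> (nat \<Rightarrow> 's) \<Rightarrow> real"
    and f :: "(nat \<Rightarrow> 'a) \<Rightarrow> 'x \<Rightarrow> 'x \<Rightarrow> real"
    and \<delta> :: real
    and G :: "'p \<Rightarrow> ('a, 'x, nat \<Rightarrow> 's) basic_game"
    and Ts :: "nat \<Rightarrow> 't set"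
    and TT :: "(nat \<Rightarrow> 't) set"
    and \<pi> :: "'x \<Rightarrow> (nat \<Rightarrow> 's) \<Rightarrow> (nat \<Rightarrow> 't) \<Rightarrow> real"
    and S :: "('t, 'x, nat \<Rightarrow> 's) info_structure"
    and \<phi> :: "'x \<Rightarrow> (nat \<Rightarrow> 'a) \<Rightarrow> real"
    and \<alpha> :: real
    and M :: "nat \<Rightarrow> 'w measure"
    and \<Phi> :: "nat \<Rightarrow> 'w \<Rightarrow> ('x \<Rightarrow> (nat \<Rightarrow> 'a) \<Rightarrow> real) set"
  assumes G: "G = baseline_family N A u X E \<psi> f \<delta>"
    and S: "S = \<lparr> i_signals = Ts, i_prob = \<pi> \<rparr>"
    and AA: "AA = PiE {1..N} A"
    and TT: "TT = PiE {1..N} Ts"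
    and latent: "E \<subseteq> PiE {1..N} Es"
    and trans: "\<And>a x. a \<in> AA \<Longrightarrow> x \<in> X \<Longrightarrow> dist_on X (f a x)"
    and games: "\<And>\<theta>. \<theta> \<in> \<Theta> \<Longrightarrow> is_basic_game (G \<theta>)"
    and info: "\<And>\<theta>. \<theta> \<in> \<Theta> \<Longrightarrow> is_info_structure (G \<theta>) S"
    and ccp: "\<And>x. x \<in> X \<Longrightarrow> dist_on AA (\<phi> x)"
    and ccp_vec: "\<phi> \<in> ccp_space X AA"
    and alpha: "0 < \<alpha>" "\<alpha> < 1"
    and samples: "\<And>n. prob_space (M n)"
    and region: "\<And>n \<omega>. \<omega> \<in> space (M n) \<Longrightarrow> \<Phi> n \<omega> \<subseteq> ccp_space X AA"
    and meas_ccp: "\<And>n. {\<omega> \<in> space (M n). \<phi> \<in> \<Phi> n \<omega>} \<in> sets (M n)"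
    and meas_id: "\<And>n. {\<omega> \<in> space (M n).
        identified_set \<Theta> G S \<phi> \<subseteq> confidence_set \<Theta> G S (\<Phi> n \<omega>)} \<in> sets (M n)"
    and coverage: "liminf (\<lambda>n. ereal (measure (M n) {\<omega> \<in> space (M n). \<phi> \<in> \<Phi> n \<omega>}))
        \<ge> ereal (1 - \<alpha>)"
  shows "liminf (\<lambda>n. ereal (measure (M n) {\<omega> \<in> space (M n).
            identified_set \<Theta> G S \<phi> \<subseteq> confidence_set \<Theta> G S (\<Phi> n \<omega>)}))
          \<ge> ereal (1 - \<alpha>)
     \<and> (\<forall>n. \<forall>\<omega>\<in>space (M n). \<forall>\<theta>\<in>\<Theta>.
          \<theta> \<in> confidence_set \<Theta> G S (\<Phi> n \<omega>) \<longleftrightarrow>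
          (\<exists>(\<sigma> :: 'x \<Rightarrow> (nat \<Rightarrow> 's) \<Rightarrow> (nat \<Rightarrow> 't) \<Rightarrow> (nat \<Rightarrow> 'a) \<Rightarrow> real)
             (V :: nat \<Rightarrow> 'x \<Rightarrow> real) (p :: 'x \<Rightarrow> (nat \<Rightarrow> 'a) \<Rightarrow> real).
             let v = (\<lambda>i a x s. u \<theta> i a x s + \<delta> * (\<Sum>x'\<in>X. V i x' * f a x x'));
                 dv = (\<lambda>i b' a x s. v i (a(i := b')) x s - v i a x s)
             in p \<in> \<Phi> n \<omega> \<and>
                (\<forall>x\<in>X. \<forall>e\<in>E. \<forall>t\<in>TT.
                   (\<forall>a\<in>AA. 0 \<le> \<sigma> x e t a) \<and> (\<Sum>a\<in>AA. \<sigma> x e t a) = 1) \<and>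
                (\<forall>x\<in>X. \<forall>a\<in>AA.
                   p x a = (\<Sum>e\<in>E. \<Sum>t\<in>TT. \<psi> \<theta> x e * \<pi> x e t * \<sigma> x e t a)) \<and>
                (\<forall>i\<in>{1..N}. \<forall>x\<in>X. \<forall>ti\<in>Ts i. \<forall>b\<in>A i. \<forall>b'\<in>A i.
                   (\<Sum>e\<in>E. \<Sum>t | t \<in> TT \<and> t i = ti. \<Sum>a | a \<in> AA \<and> a i = b.
                      \<psi> \<theta> x e * \<pi> x e t * \<sigma> x e t a * dv i b' a x (e i)) \<le> 0) \<and>
                (\<forall>i\<in>{1..N}. \<forall>x\<in>X.
                   V i x = (\<Sum>e\<in>E. \<Sum>t\<in>TT. \<Sum>a\<in>AA.
                              \<psi> \<theta> x e * \<pi> x e t * \<sigma> x e t a * u \<theta> i a x (e i))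
                         + \<delta> * (\<Sum>a\<in>AA. \<Sum>x'\<in>X. p x a * V i x' * f a x x'))))"
proof (intro conjI allI ballI)
  \<comment> \<open>The event inclusion holds at every sample size, so the lower limits compare
    termwise. Monotonicity of the measure asks for measurability of the larger event, which is
    \<open>meas_id\<close>.\<close>
  have "ereal (measure (M n) {\<omega> \<in> space (M n). \<phi> \<in> \<Phi> n \<omega>})
      \<le> ereal (measure (M n) {\<omega> \<in> space (M n).
          identified_set \<Theta> G S \<phi> \<subseteq> confidence_set \<Theta> G S (\<Phi> n \<omega>)})" for n
  proof -
    interpret prob_space "M n" by (rule samples)
    show ?thesis
      unfolding ereal_less_eq
      by (intro finite_measure_mono meas_id) (auto simp: confidence_set_def)
  qed
  hence "liminf (\<lambda>n. ereal (measure (M n) {\<omega> \<in> space (M n). \<phi> \<in> \<Phi> n \<omega>}))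
      \<le> liminf (\<lambda>n. ereal (measure (M n) {\<omega> \<in> space (M n).
          identified_set \<Theta> G S \<phi> \<subseteq> confidence_set \<Theta> G S (\<Phi> n \<omega>)}))"
    by (intro Liminf_mono always_eventually allI)
  with coverage show "ereal (1 - \<alpha>) \<le> liminf (\<lambda>n. ereal (measure (M n) {\<omega> \<in> space (M n).
      identified_set \<Theta> G S \<phi> \<subseteq> confidence_set \<Theta> G S (\<Phi> n \<omega>)}))"
    by (rule order.trans)
next
  fix n \<omega> \<theta>
  assume \<theta>: "\<theta> \<in> \<Theta>"
  note game = games[OF \<theta>] and information = info[OF \<theta>]
  have G\<theta>: "players (G \<theta>) = {1..N}" "g_acts (G \<theta>) = A" "action_profiles (G \<theta>) = AA"
      "signal_profiles (G \<theta>) S = TT" "g_states (G \<theta>) = X" "g_latent (G \<theta>) = E"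
      "g_prior (G \<theta>) = \<psi> \<theta>" "i_prob S = \<pi>" "i_signals S = Ts" "g_disc (G \<theta>) = \<delta>"
      "g_payoff (G \<theta>) i a x e = u \<theta> i a x (e i)" "g_trans (G \<theta>) a x e = f a x" for i a x e
    by (auto simp: G S AA TT baseline_family_def players_def action_profiles_def
        signal_profiles_def)
  \<comment> \<open>The system is split into feasibility \<open>rule\<close>, consistency
    \<open>cons\<close>, obedience \<open>obed\<close> and the Bellman equation \<open>bell\<close>.
    In \<open>obed\<close> the values \<open>V\<close> are free; only \<open>bell\<close> ties them
    to \<open>\<sigma>\<close>.\<close>
  define rule where "rule \<sigma> \<longleftrightarrow> (\<forall>x\<in>X. \<forall>e\<in>E. \<forall>t\<in>TT.
      (\<forall>a\<in>AA. 0 \<le> \<sigma> x e t a) \<and> (\<Sum>a\<in>AA. \<sigma> x e t a) = 1)"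
    for \<sigma> :: "('a, 'x, nat \<Rightarrow> 's, 't) decision_rule"
  define cons where "cons \<sigma> p \<longleftrightarrow> (\<forall>x\<in>X. \<forall>a\<in>AA.
      p x a = (\<Sum>e\<in>E. \<Sum>t\<in>TT. \<psi> \<theta> x e * \<pi> x e t * \<sigma> x e t a))"
    for \<sigma> :: "('a, 'x, nat \<Rightarrow> 's, 't) decision_rule" and p
  define v where "v V i a x s = u \<theta> i a x s + \<delta> * (\<Sum>x'\<in>X. V i x' * f a x x')"
    for V :: "nat \<Rightarrow> 'x \<Rightarrow> real" and i a x s
  define obed where "obed \<sigma> V \<longleftrightarrow> (\<forall>i\<in>{1..N}. \<forall>x\<in>X. \<forall>ti\<in>Ts i. \<forall>b\<in>A i. \<forall>b'\<in>A i.
      (\<Sum>e\<in>E. \<Sum>t | t \<in> TT \<and> t i = ti. \<Sum>a | a \<in> AA \<and> a i = b.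
         \<psi> \<theta> x e * \<pi> x e t * \<sigma> x e t a * (v V i (a(i := b')) x (e i) - v V i a x (e i))) \<le> 0)"
    for \<sigma> :: "('a, 'x, nat \<Rightarrow> 's, 't) decision_rule" and V
  define bell where "bell \<sigma> p V \<longleftrightarrow> (\<forall>i\<in>{1..N}. \<forall>x\<in>X.
      V i x = (\<Sum>e\<in>E. \<Sum>t\<in>TT. \<Sum>a\<in>AA.
                 \<psi> \<theta> x e * \<pi> x e t * \<sigma> x e t a * u \<theta> i a x (e i))
            + \<delta> * (\<Sum>a\<in>AA. \<Sum>x'\<in>X. p x a * V i x' * f a x x'))"
    for \<sigma> :: "('a, 'x, nat \<Rightarrow> 's, 't) decision_rule" and p V
  have rule: "is_decision_rule (G \<theta>) S \<sigma> \<longleftrightarrow> rule \<sigma>" for \<sigma>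
    by (simp add: is_decision_rule_def dist_on_def rule_def G\<theta>)
  \<comment> \<open>Agreement of \<open>V\<close> with the ex ante value is asked only for actual
    players and on \<open>X\<close>, so that \<open>V\<close> may be the ex ante value itself or an
    arbitrary solution of the system.\<close>
  have MCE: "is_MCE (G \<theta>) S \<sigma> \<longleftrightarrow> rule \<sigma> \<and> obed \<sigma> V"
    if V: "\<And>i x. i \<in> {1..N} \<Longrightarrow> x \<in> X \<Longrightarrow> V i x = ex_ante_value (G \<theta>) S \<sigma> i x" for \<sigma> V
  proof -
    have "choice_value (G \<theta>) S \<sigma> i a x e = v V i a x (e i)" if "i \<in> {1..N}" for i a x e
      using V[OF that] by (simp add: choice_value_def v_def G\<theta>)
    thus ?thesis
      by (simp add: is_MCE_def obed_def rule G\<theta> right_diff_distrib sum_subtractf)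
  qed
  \<comment> \<open>The stated equation leaves \<open>V i\<close> free outside \<open>X\<close>,
    whereas \<open>is_value\<close> requires extensionality; hence the restriction. Consistency
    makes \<open>p\<close> the marginal needed by \<open>bellman_marginal\<close>.\<close>
  have bell: "bell \<sigma> p V \<longleftrightarrow> (\<forall>i\<in>{1..N}. is_value (G \<theta>) S \<sigma> i (restrict (V i) X))"
    if "cons \<sigma> p" for \<sigma> p V
  proof -
    have "(\<Sum>e\<in>E. \<Sum>t\<in>TT. \<Sum>a\<in>AA. \<psi> \<theta> x e * \<pi> x e t * \<sigma> x e t a *
          (u \<theta> i a x (e i) + \<delta> * (\<Sum>x'\<in>X. V i x' * f a x x')))
        = (\<Sum>e\<in>E. \<Sum>t\<in>TT. \<Sum>a\<in>AA. \<psi> \<theta> x e * \<pi> x e t * \<sigma> x e t a * u \<theta> i a x (e i))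
          + \<delta> * (\<Sum>a\<in>AA. \<Sum>x'\<in>X. p x a * V i x' * f a x x')" if "x \<in> X" for i x
      using \<open>cons \<sigma> p\<close> that by (intro bellman_marginal) (simp add: cons_def)
    thus ?thesis
      by (simp add: bell_def is_value_def G\<theta>)
  qed
  have "(\<exists>\<sigma>. is_MCE (G \<theta>) S \<sigma> \<and> cons \<sigma> p) \<longleftrightarrow>
      (\<exists>\<sigma> V. rule \<sigma> \<and> cons \<sigma> p \<and> obed \<sigma> V \<and> bell \<sigma> p V)" for p
  proof
    assume "\<exists>\<sigma>. is_MCE (G \<theta>) S \<sigma> \<and> cons \<sigma> p"
    then obtain \<sigma> where \<sigma>: "is_MCE (G \<theta>) S \<sigma>" "cons \<sigma> p" by blast
    \<comment> \<open>From an equilibrium, the witness for \<open>V\<close> is its own ex ante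
      value.\<close>
    let ?V = "ex_ante_value (G \<theta>) S \<sigma>"
    have dr: "rule \<sigma>" and "obed \<sigma> ?V"
      using \<sigma>(1) MCE[of ?V \<sigma>] by auto
    have "is_value (G \<theta>) S \<sigma> i (?V i)" for i
      using is_value_ex_ante_value[OF game information] dr by (simp add: rule)
    moreover from this have "restrict (?V i) X = ?V i" for i
      by (intro extensional_restrict) (simp add: is_value_def G\<theta>)
    ultimately have "bell \<sigma> p ?V"
      using bell[OF \<sigma>(2)] by simp
    with dr \<sigma>(2) \<open>obed \<sigma> ?V\<close>
    show "\<exists>\<sigma> V. rule \<sigma> \<and> cons \<sigma> p \<and> obed \<sigma> V \<and> bell \<sigma> p V" by blast
  next
    assume "\<exists>\<sigma> V. rule \<sigma> \<and> cons \<sigma> p \<and> obed \<sigma> V \<and> bell \<sigma> p V"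
    then obtain \<sigma> V where *: "rule \<sigma>" "cons \<sigma> p" "obed \<sigma> V" "bell \<sigma> p V" by blast
    \<comment> \<open>Uniqueness of the Bellman solution identifies the given \<open>V\<close> with
      the ex ante value on \<open>X\<close>, so obedience with respect to \<open>V\<close> is
      equilibrium obedience.\<close>
    have "ex_ante_value (G \<theta>) S \<sigma> i = restrict (V i) X" if "i \<in> {1..N}" for i
      using ex_ante_value_eqI[OF game information] * that bell[OF *(2)] by (simp add: rule)
    hence "is_MCE (G \<theta>) S \<sigma>"
      using MCE[of V \<sigma>] * by simp
    with *(2) show "\<exists>\<sigma>. is_MCE (G \<theta>) S \<sigma> \<and> cons \<sigma> p" by blast
  qed
  moreover have "\<theta> \<in> confidence_set \<Theta> G S (\<Phi> n \<omega>) \<longleftrightarrow>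
      (\<exists>p\<in>\<Phi> n \<omega>. \<exists>\<sigma>. is_MCE (G \<theta>) S \<sigma> \<and> cons \<sigma> p)"
    using \<theta> by (simp add: confidence_set_def identified_set_def cons_def G\<theta>)
  ultimately have iff: "\<theta> \<in> confidence_set \<Theta> G S (\<Phi> n \<omega>) \<longleftrightarrow>
      (\<exists>\<sigma> V p. p \<in> \<Phi> n \<omega> \<and> rule \<sigma> \<and> cons \<sigma> p \<and> obed \<sigma> V \<and> bell \<sigma> p V)"
    by blast
  show "\<theta> \<in> confidence_set \<Theta> G S (\<Phi> n \<omega>) \<longleftrightarrow>
          (\<exists>(\<sigma> :: 'x \<Rightarrow> (nat \<Rightarrow> 's) \<Rightarrow> (nat \<Rightarrow> 't) \<Rightarrow> (nat \<Rightarrow> 'a) \<Rightarrow> real)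
             (V :: nat \<Rightarrow> 'x \<Rightarrow> real) (p :: 'x \<Rightarrow> (nat \<Rightarrow> 'a) \<Rightarrow> real).
             let v = (\<lambda>i a x s. u \<theta> i a x s + \<delta> * (\<Sum>x'\<in>X. V i x' * f a x x'));
                 dv = (\<lambda>i b' a x s. v i (a(i := b')) x s - v i a x s)
             in p \<in> \<Phi> n \<omega> \<and>
                (\<forall>x\<in>X. \<forall>e\<in>E. \<forall>t\<in>TT.
                   (\<forall>a\<in>AA. 0 \<le> \<sigma> x e t a) \<and> (\<Sum>a\<in>AA. \<sigma> x e t a) = 1) \<and>
                (\<forall>x\<in>X. \<forall>a\<in>AA.
                   p x a = (\<Sum>e\<in>E. \<Sum>t\<in>TT. \<psi> \<theta> x e * \<pi> x e t * \<sigma> x e t a)) \<and>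
                (\<forall>i\<in>{1..N}. \<forall>x\<in>X. \<forall>ti\<in>Ts i. \<forall>b\<in>A i. \<forall>b'\<in>A i.
                   (\<Sum>e\<in>E. \<Sum>t | t \<in> TT \<and> t i = ti. \<Sum>a | a \<in> AA \<and> a i = b.
                      \<psi> \<theta> x e * \<pi> x e t * \<sigma> x e t a * dv i b' a x (e i)) \<le> 0) \<and>
                (\<forall>i\<in>{1..N}. \<forall>x\<in>X.
                   V i x = (\<Sum>e\<in>E. \<Sum>t\<in>TT. \<Sum>a\<in>AA.
                              \<psi> \<theta> x e * \<pi> x e t * \<sigma> x e t a * u \<theta> i a x (e i))
                         + \<delta> * (\<Sum>a\<in>AA. \<Sum>x'\<in>X. p x a * V i x' * f a x x')))"
    unfolding Let_def using iff unfolding rule_def cons_def obed_def bell_def v_def .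
qed

end
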